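(* If $G$ is a connected graph with non-increasing degree sequence $d=(d_1,\ldots,d_n)$ and with exactly $n-1+k$ edges for some non-negative integer $k$, then $$\gamma(G)\le 3\,s\ell(d)+2k-2.$$
   Context: All graphs are finite, simple and undirected. $[n]=\{1,\ldots,n\}$. A set $D$ of vertices of $G$ is a dominating set if every vertex in $V(G)\setminus D$ has a neighbor in $D$; $\gamma(G)$ is the minimum order of a dominating set of $G$. For a non-increasing sequence $d=(d_1,\ldots,d_n)$, $$s\ell(d)=\min\Big\{j\in[n]:\sum_{i=1}^j d_i\ge n-j\Big\}.$$ *)

theory Defs
  imports "Graph_Theory.Digraph_Component" "HOL-Library.Multiset"
begin

text \<open>
  A finite simple undirected graph is an instance of the locale \<^locale>\<open>graph\<close>: a finite symmetric
  digraph without loops and parallel arcs. Every undirected edge is represented by two opposite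
  arcs, so edges have to be counted as unordered pairs of end vertices, while the degree of a
  vertex is its \<^const>\<open>out_degree\<close>.
\<close>

definition edges :: "('a, 'b) pre_digraph \<Rightarrow> 'a set set" where
  "edges G = {{tail G e, head G e} | e. e \<in> arcs G}"

definition dominating_set :: "('a, 'b) pre_digraph \<Rightarrow> 'a set \<Rightarrow> bool" where
  "dominating_set G D \<longleftrightarrow>
     D \<subseteq> verts G \<and> (\<forall>v \<in> verts G - D. \<exists>u \<in> D. v \<rightarrow>\<^bsub>G\<^esub> u)"

definition domination_number :: "('a, 'b) pre_digraph \<Rightarrow> nat" where
  "domination_number G = Min {card D | D. dominating_set G D}"

definition degree_sequence :: "('a, 'b) pre_digraph \<Rightarrow> nat list \<Rightarrow> bool" where
  "degree_sequence G d \<longleftrightarrow>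
     sorted_wrt (\<ge>) d \<and> mset d = image_mset (out_degree G) (mset_set (verts G))"

text \<open>
  Lists are indexed from \<open>0\<close>, so the sum of the first \<open>j\<close> entries ranges over \<open>i < j\<close>. The
  subtraction on natural numbers is exact because \<open>j \<le> length d\<close>, and for nonempty \<open>d\<close> the set
  contains \<open>length d\<close>.
\<close>

definition slater_number :: "nat list \<Rightarrow> nat" where
  "slater_number d = Min {j \<in> {1..length d}. (\<Sum>i<j. d ! i) \<ge> length d - j}"

end

theory Submission
  imports Defs "HOL-Combinatorics.Permutations"
begin

text \<open>
  Let \<open>s\<close> be the Slater number and let \<open>S\<close> be a set of \<open>s\<close> vertices whose degrees sum to at
  least \<open>n - s\<close>. The set \<open>S\<close> together with all vertices of degree at least two is dominating: a
  leaf outside of it would have a leaf outside of \<open>S\<close> as its only neighbour, and these two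
  vertices would form a component missing \<open>S\<close>. The degrees outside \<open>S\<close> sum to at most
  \<open>2 (n - 1 + k) - (n - s) = (n - s) + 2 s + 2 k - 2\<close>, and each of these \<open>n - s\<close> degrees is positive,
  so at most \<open>2 s + 2 k - 2\<close> of them are at least two.
\<close>

text \<open>Turns the first \<open>j\<close> entries of a degree sequence into a set of
  \<open>j\<close> vertices with the same degree sum. Ties among the values do not matter: the
  elements themselves are permuted, not just their values.\<close>

lemma mset_prefix_as_subset:
  assumes "mset xs = image_mset f (mset_set A)" "finite A" "j \<le> length xs"
  obtains B where "B \<subseteq> A" "card B = j" "sum f B = (\<Sum>i<j. xs ! i)"
proof -
  obtain ys where ys: "mset ys = mset_set A"
    using ex_mset by blast
  then have "mset xs = mset (map f ys)"
    using assms(1) by simp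
  then obtain p where p: "p permutes {..<length (map f ys)}" "permute_list p (map f ys) = xs"
    by (rule mset_eq_permutation)
  \<comment> \<open>The permutation that rearranges the values of \<open>f\<close> into
    \<open>xs\<close> is applied to the underlying elements, so \<open>zs\<close> enumerates
    \<open>A\<close> in an order matching \<open>xs\<close>.\<close>
  define zs where "zs = permute_list p ys"
  have xs: "xs = map f zs"
    using p by (simp add: zs_def permute_list_map)
  have zs: "mset zs = mset_set A"
    using p ys by (simp add: zs_def)
  have "set zs = A"
    using zs \<open>finite A\<close> by (metis finite_set_mset_mset_set set_mset_mset)
  have "distinct zs"
    using zs \<open>set zs = A\<close> \<open>finite A\<close> by (simp add: distinct_count_atmost_1 count_mset_set')
  show ?thesis
  proof
    show "set (take j zs) \<subseteq> A"
      using set_take_subset[of j zs] \<open>set zs = A\<close> by simp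
    show "card (set (take j zs)) = j"
      using \<open>distinct zs\<close> assms(3) xs by (simp add: distinct_card)
    have "sum f (set (take j zs)) = sum_list (take j xs)"
      using \<open>distinct zs\<close> xs by (simp add: sum_list_distinct_conv_sum_set take_map)
    also have "\<dots> = (\<Sum>i<j. xs ! i)"
      using assms(3) by (simp add: sum_list_sum_nth atLeast0LessThan)
    finally show "sum f (set (take j zs)) = (\<Sum>i<j. xs ! i)" .
  qed
qed

lemma slater_number_props:
  assumes "d \<noteq> []"
  shows "slater_number d \<in> {1..length d}"
    and "length d - slater_number d \<le> (\<Sum>i<slater_number d. d ! i)"
proof -
  let ?A = "{j \<in> {1..length d}. (\<Sum>i<j. d ! i) \<ge> length d - j}"
  have "length d \<in> ?A"
    using assms by (simp add: Suc_le_eq)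
  then have "slater_number d \<in> ?A"
    unfolding slater_number_def by (intro Min_in) auto
  then show "slater_number d \<in> {1..length d}"
    and "length d - slater_number d \<le> (\<Sum>i<slater_number d. d ! i)"
    by auto
qed

lemma (in fin_digraph) sum_out_degree: "(\<Sum>v \<in> verts G. out_degree G v) = card (arcs G)"
proof -
  have "tail G ` arcs G \<subseteq> verts G"
    by auto
  from sum.group[OF finite_arcs finite_verts this, of "\<lambda>_. 1 :: nat"] show ?thesis
    by (simp add: out_degree_def out_arcs_def)
qed

text \<open>Arcs are grouped by their unordered pair of ends. Without parallel arcs, an arc is
  determined by its ordered pair of ends, and an unordered pair has at most two orderings.\<close>

lemma (in digraph) card_arcs_le: "card (arcs G) \<le> 2 * card (edges G)"
proof -
  let ?ends = "\<lambda>e. {tail G e, head G e}"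
  have fin: "finite (edges G)"
    by (simp add: edges_def Setcompr_eq_image)
  have fibre: "card {e \<in> arcs G. ?ends e = E} \<le> 2" if mem: "E \<in> edges G" for E
  proof -
    obtain u v where E: "E = {u, v}"
      using mem by (auto simp: edges_def)
    have "inj_on (arc_to_ends G) {e \<in> arcs G. ?ends e = E}"
      by (auto intro!: inj_onI no_multi_arcs)
    moreover have "arc_to_ends G ` {e \<in> arcs G. ?ends e = E} \<subseteq> {(u, v), (v, u)}"
      using no_loops by (auto simp: E arc_to_ends_def doubleton_eq_iff)
    ultimately have "card {e \<in> arcs G. ?ends e = E} \<le> card {(u, v), (v, u)}"
      by (intro card_inj_on_le) auto
    also have "\<dots> \<le> 2"
      using card_length[of "[(u, v), (v, u)]"] by simp
    finally show ?thesis .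
  qed
  have "card (arcs G) = (\<Sum>E \<in> edges G. card {e \<in> arcs G. ?ends e = E})"
    using sum.group[OF finite_arcs fin, of ?ends "\<lambda>_. 1 :: nat"]
    by (simp add: edges_def Setcompr_eq_image)
  also have "\<dots> \<le> (\<Sum>E \<in> edges G. 2)"
    by (intro sum_mono fibre)
  finally show ?thesis
    by simp
qed

lemma (in fin_digraph) domination_number_le:
  assumes "dominating_set G D"
  shows "domination_number G \<le> card D"
proof -
  have "{D. dominating_set G D} \<subseteq> Pow (verts G)"
    by (auto simp: dominating_set_def)
  then have "finite {D. dominating_set G D}"
    by (rule finite_subset) simp
  then show ?thesis
    unfolding domination_number_def using assms by (intro Min_le) (auto simp: Setcompr_eq_image)
qed

context graph
begin

text \<open>Connectedness is defined as strong connectedness of the symmetric closure, and closing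
  an already symmetric digraph leaves reachability unchanged.\<close>

lemma connected_reachable:
  assumes "Digraph_Component.connected G" "u \<in> verts G" "v \<in> verts G"
  shows "u \<rightarrow>\<^sup>* v"
  using assms
  by (simp add: connected_def strongly_connected_def reachable_mk_symmetric_eq sym_arcs)

lemma connected_neighbour:
  assumes "Digraph_Component.connected G" "u \<in> verts G" "v \<in> verts G" "u \<noteq> v"
  obtains w where "u \<rightarrow>\<^bsub>G\<^esub> w"
  using connected_reachable[OF assms(1-3)] assms(4) by (auto elim: converse_reachable_cases)

lemma out_degree_pos:
  assumes "u \<rightarrow>\<^bsub>G\<^esub> v"
  shows "0 < out_degree G u"
proof -
  obtain e where "e \<in> out_arcs G u"
    using assms by (auto simp: arcs_ends_conv)
  then show ?thesis
    unfolding out_degree_def using finite_out_arcs by (auto simp only: card_gt_0_iff)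
qed

lemma leaf_neighbour_unique:
  assumes "out_degree G u < 2" "u \<rightarrow>\<^bsub>G\<^esub> v" "u \<rightarrow>\<^bsub>G\<^esub> w"
  shows "v = w"
proof -
  obtain e f where "e \<in> out_arcs G u" "head G e = v" "f \<in> out_arcs G u" "head G f = w"
    using assms(2,3) by (auto simp: arcs_ends_conv)
  moreover have "card (out_arcs G u) \<le> 1"
    using assms(1) by (simp add: out_degree_def)
  ultimately show ?thesis
    by (metis card_le_Suc0_iff_eq finite_out_arcs One_nat_def)
qed

lemma dominating_set_with_nonleaves:
  assumes conn: "Digraph_Component.connected G" and S: "S \<subseteq> verts G" "S \<noteq> {}"
  shows "dominating_set G (S \<union> {v \<in> verts G - S. 2 \<le> out_degree G v})" (is "dominating_set G ?D")
proof -
  have "\<exists>w \<in> ?D. u \<rightarrow>\<^bsub>G\<^esub> w" if u: "u \<in> verts G - ?D" for u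
  proof (rule ccontr)
    assume no: "\<not> (\<exists>w \<in> ?D. u \<rightarrow>\<^bsub>G\<^esub> w)"
    obtain s where s: "s \<in> S"
      using S by blast
    then obtain w where uw: "u \<rightarrow>\<^bsub>G\<^esub> w"
      using connected_neighbour[OF conn, of u s] u S by blast
    then have w: "w \<in> verts G - ?D"
      using no adj_in_verts(2) by blast
    have wu: "w \<rightarrow>\<^bsub>G\<^esub> u"
      using uw sym_arcs by (auto simp: symmetric_def dest: symD)
    \<comment> \<open>Neither \<open>u\<close> nor \<open>w\<close> is in \<open>?D\<close>, so both
      have degree below two and each is the only neighbour of the other: no walk from
      \<open>u\<close> leaves \<open>{u, w}\<close>.\<close>
    have "x \<in> {u, w}" if "u \<rightarrow>\<^sup>* x" for x
      using that
    proof (induction rule: reachable_induct)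
      case (step x y)
      have "out_degree G u < 2" "out_degree G w < 2"
        using u w by auto
      then show ?case
        using step.IH step.hyps(2) leaf_neighbour_unique[OF _ uw] leaf_neighbour_unique[OF _ wu]
        by blast
    qed simp
    then have "s \<in> {u, w}"
      using connected_reachable[OF conn, of u s] u s S by blast
    then show False
      using s u w by blast
  qed
  then show ?thesis
    using S by (auto simp: dominating_set_def)
qed

text \<open>A handshake count, written additively to avoid truncated subtraction: each vertex
  outside \<open>S\<close> contributes at least 1 to the degree sum, and each non-leaf there at
  least 1 more.\<close>

lemma card_nonleaves_outside:
  assumes conn: "Digraph_Component.connected G" and S: "S \<subseteq> verts G" "S \<noteq> {}"
  shows "card {v \<in> verts G - S. 2 \<le> out_degree G v} + card (verts G) + (\<Sum>v \<in> S. out_degree G v)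
    \<le> 2 * card (edges G) + card S"
proof -
  have fin: "finite S"
    using S(1) by (rule finite_subset) simp
  \<comment> \<open>An element of \<open>S\<close> is a vertex different from \<open>v\<close>, so a
    walk from \<open>v\<close> to it has a first arc.\<close>
  have pos: "1 \<le> out_degree G v" if "v \<in> verts G - S" for v
  proof -
    obtain s where "s \<in> S"
      using S by blast
    with that show ?thesis
      using S connected_neighbour[OF conn, of v s] out_degree_pos
      by (metis DiffE One_nat_def Suc_leI subsetD)
  qed
  have "card {v \<in> verts G - S. 2 \<le> out_degree G v} + card (verts G - S)
    = (\<Sum>v \<in> verts G - S. (if 2 \<le> out_degree G v then 1 else 0) + 1)"
    unfolding sum.distrib by (simp flip: sum.inter_filter)
  also have "\<dots> \<le> (\<Sum>v \<in> verts G - S. out_degree G v)"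
    using pos by (intro sum_mono) auto
  also have "\<dots> + (\<Sum>v \<in> S. out_degree G v) = card (arcs G)"
    using sum.subset_diff[OF S(1) finite_verts, of "out_degree G"] sum_out_degree by simp
  finally show ?thesis
    using card_arcs_le S fin card_mono[OF finite_verts S(1)] by (simp add: card_Diff_subset)
qed

end

theorem theorem12:
  fixes G :: "('a, 'b) pre_digraph" and d :: "nat list" and k :: nat
  assumes "graph G"
    and "Digraph_Component.connected G"
    and "degree_sequence G d"
    and "int (card (edges G)) = int (length d) - 1 + int k"
  shows "int (domination_number G) \<le> 3 * int (slater_number d) + 2 * int k - 2"
proof -
  interpret graph G
    by fact
  define s where "s = slater_number d"
  have d: "mset d = image_mset (out_degree G) (mset_set (verts G))"
    using assms(3) by (simp add: degree_sequence_def)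
  then have n: "length d = card (verts G)"
    by (metis size_image_mset size_mset size_mset_set)
  \<comment> \<open>Strong connectedness includes having a vertex.\<close>
  have "verts G \<noteq> {}"
    using assms(2) by (auto simp: connected_def strongly_connected_def)
  then have "d \<noteq> []"
    using n by auto
  then have s: "1 \<le> s" "s \<le> length d" "length d - s \<le> (\<Sum>i<s. d ! i)"
    using slater_number_props[of d] by (auto simp: s_def)
  obtain S where S: "S \<subseteq> verts G" "card S = s" "sum (out_degree G) S = (\<Sum>i<s. d ! i)"
    using mset_prefix_as_subset[OF d finite_verts s(2)] .
  have "S \<noteq> {}"
    using S(2) s(1) by auto
  let ?B = "{v \<in> verts G - S. 2 \<le> out_degree G v}"
  have "domination_number G \<le> card (S \<union> ?B)"
    by (intro domination_number_le dominating_set_with_nonleaves assms(2) S(1) \<open>S \<noteq> {}\<close>)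
  also have "\<dots> \<le> s + card ?B"
    using card_Un_le[of S ?B] S(2) by simp
  \<comment> \<open>With \<open>n = length d\<close>, the count gives \<open>card ?B\<close> \<le>
    \<open>2 * (n - 1 + k) + s - n - (n - s)\<close> = \<open>2 * s + 2 * k - 2\<close>; the other
    \<open>s\<close> comes from \<open>S\<close>.\<close>
  finally show ?thesis
    using card_nonleaves_outside[OF assms(2) S(1) \<open>S \<noteq> {}\<close>] assms(4) s S n unfolding s_def
    by linarith
qed

end
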